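(* Let $d\ge 1$, $\gamma\ge 0$, and let $(\mathbf X,\mathbf Y)$ be a random element of $\mathbb R^d\times\{0,1\}^d$ such that $Y_1,\dots,Y_d$ are conditionally independent given $\mathbf X$ and such that, with probability one, the conditional probabilities $p_j(\mathbf X)=\mathbb P(Y_j=1\mid \mathbf X)$, $j=1,\dots,d$, are pairwise distinct. Then a measurable segmentation rule $\boldsymbol\delta^*:\mathbb R^d\to\{0,1\}^d$ is a global maximizer of $\mathrm{IoU}_\gamma(\boldsymbol\delta)$ over all measurable $\boldsymbol\delta:\mathbb R^d\to\{0,1\}^d$ if and only if, for $\mathbb P_{\mathbf X}$-almost every $\mathbf x$, $$\delta^*_j(\mathbf x)=\begin{cases}1 & \text{if } p_j(\mathbf x)\text{ is among the } \tau^*(\mathbf x) \text{ largest of } p_1(\mathbf x),\dots,p_d(\mathbf x),\\ 0&\text{otherwise,}\end{cases}\qquad j=1,\dots,d,$$ for some optimal volume $$\tau^*(\mathbf x)\in\operatorname*{argmax}_{\tau\in\{0,1,\dots,d\}}\Big(\sum_{j\in J_\tau(\mathbf x)}p_j(\mathbf x)+\gamma\Big)\sum_{l=0}^{d-\tau}\frac{1}{\tau+l+\gamma}\,\mathbb P\big(\Gamma_{-J_\tau(\mathbf x)}(\mathbf x)=l\big).$$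
   Context: For a measurable segmentation rule $\boldsymbol\delta:\mathbb R^d\to\{0,1\}^d$, $$\mathrm{IoU}_\gamma(\boldsymbol\delta)=\mathbb E\Big(\frac{\mathbf Y^\top\boldsymbol\delta(\mathbf X)+\gamma}{\|\mathbf Y\|_1+\|\boldsymbol\delta(\mathbf X)\|_1-\mathbf Y^\top\boldsymbol\delta(\mathbf X)+\gamma}\Big),$$ with the convention $0/0:=0$ (relevant only when $\gamma=0$); correspondingly, when $\gamma=0$ the objective defining $\tau^*(\mathbf x)$ is taken to be $0$ at $\tau=0$. $J_\tau(\mathbf x)=\{j:\sum_{j'=1}^d\mathbf 1(p_{j'}(\mathbf x)\ge p_j(\mathbf x))\le\tau\}$ is the index set of the $\tau$ largest conditional probabilities, with $J_0(\mathbf x)=\emptyset$. For fixed $\mathbf x$, $B_1(\mathbf x),\dots,B_d(\mathbf x)$ are independent Bernoulli random variables with success probabilities $p_1(\mathbf x),\dots,p_d(\mathbf x)$, and $\Gamma_{-J_\tau(\mathbf x)}(\mathbf x)=\sum_{j'\notin J_\tau(\mathbf x)}B_{j'}(\mathbf x)$. *)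

theory Defs
  imports "HOL-Probability.Probability"
begin

definition binary_cube :: "(real ^ 'n) set" where
  "binary_cube = {y. \<forall>j. y $ j \<in> {0, 1}}"

definition segmentation_rules :: "(real ^ 'n \<Rightarrow> real ^ 'n) set" where
  "segmentation_rules = {\<delta>. \<delta> \<in> borel_measurable borel \<and> (\<forall>x. \<delta> x \<in> binary_cube)}"

definition l1_norm :: "real ^ 'n \<Rightarrow> real" where
  "l1_norm y = (\<Sum>j\<in>UNIV. \<bar>y $ j\<bar>)"

(* The convention 0/0 = 0 is that of division on type real; it matters only for gamma = 0. *)
definition IoU ::
  "'a measure \<Rightarrow> ('a \<Rightarrow> real ^ 'n) \<Rightarrow> ('a \<Rightarrow> real ^ 'n) \<Rightarrow> real \<Rightarrow>
    (real ^ 'n \<Rightarrow> real ^ 'n) \<Rightarrow> real" where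
  "IoU M X Y \<gamma> \<delta> =
    (\<integral>\<omega>. (Y \<omega> \<bullet> \<delta> (X \<omega>) + \<gamma>) /
         (l1_norm (Y \<omega>) + l1_norm (\<delta> (X \<omega>)) - Y \<omega> \<bullet> \<delta> (X \<omega>) + \<gamma>) \<partial>M)"

definition sigma_gen :: "'a measure \<Rightarrow> ('a \<Rightarrow> 'b::topological_space) \<Rightarrow> 'a measure" where
  "sigma_gen M X = vimage_algebra (space M) X borel"

definition cond_prob_given :: "'a measure \<Rightarrow> 'a measure \<Rightarrow> 'a set \<Rightarrow> 'a \<Rightarrow> real" where
  "cond_prob_given M G A = real_cond_exp M G (indicator A)"

definition cond_indep_vars ::
  "'a measure \<Rightarrow> 'a measure \<Rightarrow> ('i \<Rightarrow> 'b measure) \<Rightarrow> ('i \<Rightarrow> 'a \<Rightarrow> 'b) \<Rightarrow> 'i set \<Rightarrow> bool" where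
  "cond_indep_vars M G N Z I \<longleftrightarrow>
    (\<forall>i\<in>I. Z i \<in> measurable M (N i)) \<and>
    (\<forall>J A. J \<subseteq> I \<longrightarrow> finite J \<longrightarrow> (\<forall>j\<in>J. A j \<in> sets (N j)) \<longrightarrow>
      (AE \<omega> in M. cond_prob_given M G {\<omega>' \<in> space M. \<forall>j\<in>J. Z j \<omega>' \<in> A j} \<omega> =
        (\<Prod>j\<in>J. cond_prob_given M G {\<omega>' \<in> space M. Z j \<omega>' \<in> A j} \<omega>)))"

(* In the following definitions q stands for the vector (p_1(x), ..., p_d(x)). *)

definition top_set :: "real ^ 'n \<Rightarrow> nat \<Rightarrow> 'n set" where
  "top_set q \<tau> = {j. card {j'. q $ j' \<ge> q $ j} \<le> \<tau>}"

(* Joint law of independent Bernoulli variables with success probabilities q_j.  The pmf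
   bernoulli_pmf truncates its parameter to [0,1], so the law is also defined on the null set of
   points where a version of the conditional probabilities leaves [0,1]. *)
definition bernoulli_vec :: "real ^ 'n \<Rightarrow> ('n \<Rightarrow> bool) pmf" where
  "bernoulli_vec q = Pi_pmf UNIV False (\<lambda>j. bernoulli_pmf (q $ j))"

(* For gamma = 0 and tau = 0 the first factor is 0, hence so is the objective. *)
definition volume_objective :: "real \<Rightarrow> real ^ 'n \<Rightarrow> nat \<Rightarrow> real" where
  "volume_objective \<gamma> q \<tau> =
    ((\<Sum>j\<in>top_set q \<tau>. q $ j) + \<gamma>) *
    (\<Sum>l = 0..CARD('n) - \<tau>. 1 / (real \<tau> + real l + \<gamma>) *
       measure_pmf.prob (bernoulli_vec q) {b. (\<Sum>j\<in>- top_set q \<tau>. of_bool (b j)) = l})"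

end

theory Submission
  imports Defs
begin

text \<open>
  Conditionally on $X = x$ the labels are independent Bernoulli variables, so the gain of predicting
  a set $S$ of coordinates is a number $V(S)$ depending only on $p(x)$. The true positives in
  $S$ and the positives outside $S$ are independent, which factors $V(S)$ as
  $(\sum_{j \in S} p_j + \gamma)$ times the expectation of $1 / (|S| + \Gamma_{-S} + \gamma)$.
  Exchanging an element of $S$ for one of larger probability strictly increases $V$; hence every
  maximizer of $V$ is a set of the most probable coordinates, and for these sets $V$ is the
  volume objective. Finally, $\mathrm{IoU}_\gamma(\delta)$ is the integral of the pointwise gains,
  so a rule is optimal iff it maximizes the pointwise gain almost everywhere.
\<close>

subsection \<open>Expectations over random subsets\<close>

text \<open>The expectation of $h$ over a random subset of $K$ with independent inclusions. As a
  polynomial in $q$ it is measurable in $q$ even where $q$ leaves $[0,1]$.\<close>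

definition subset_expectation :: "('i \<Rightarrow> real) \<Rightarrow> 'i set \<Rightarrow> ('i set \<Rightarrow> real) \<Rightarrow> real" where
  "subset_expectation q K h = (\<Sum>A\<in>Pow K. (\<Prod>j\<in>A. q j) * (\<Prod>j\<in>K - A. 1 - q j) * h A)"

lemma subset_expectation_empty [simp]: "subset_expectation q {} h = h {}"
  by (simp add: subset_expectation_def)

text \<open>Conditioning on whether the random subset contains \<open>k\<close>: the subsets without
  \<open>k\<close> carry the extra weight \<open>1 - q k\<close>, those with \<open>k\<close> the
  extra weight \<open>q k\<close>. The inductions on \<open>K\<close> below run on this
  recursion.\<close>

lemma subset_expectation_insert:
  assumes "finite K" "k \<notin> K"
  shows "subset_expectation q (insert k K) h =
    (1 - q k) * subset_expectation q K h + q k * subset_expectation q K (\<lambda>A. h (insert k A))"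
proof -
  let ?w = "\<lambda>K A. (\<Prod>j\<in>A. q j) * (\<Prod>j\<in>K - A. 1 - q j)"
  have disj: "Pow K \<inter> insert k ` Pow K = {}" using assms by auto
  have inj: "inj_on (insert k) (Pow K)" using assms by (auto simp: inj_on_def)
  have out: "?w (insert k K) A = (1 - q k) * ?w K A" if "A \<in> Pow K" for A
  proof -
    have "insert k K - A = insert k (K - A)" using that assms by auto
    then show ?thesis using assms by simp
  qed
  have into: "?w (insert k K) (insert k A) = q k * ?w K A" if "A \<in> Pow K" for A
  proof -
    have "insert k K - insert k A = K - A" "finite A" "k \<notin> A"
      using that assms finite_subset by auto
    then show ?thesis by simp
  qed
  have "subset_expectation q (insert k K) h =
      (\<Sum>A\<in>Pow K. ?w (insert k K) A * h A) +
      (\<Sum>A\<in>Pow K. ?w (insert k K) (insert k A) * h (insert k A))"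
    unfolding subset_expectation_def Pow_insert
    using assms disj by (subst sum.union_disjoint) (auto simp: sum.reindex[OF inj])
  also have "\<dots> = (\<Sum>A\<in>Pow K. (1 - q k) * (?w K A * h A)) +
      (\<Sum>A\<in>Pow K. q k * (?w K A * h (insert k A)))"
    by (intro arg_cong2[where f = "(+)"] sum.cong refl) (simp_all only: out into mult.assoc)
  finally show ?thesis
    by (simp add: subset_expectation_def sum_distrib_left)
qed

lemma subset_expectation_cong:
  "(\<And>A. A \<subseteq> K \<Longrightarrow> h A = h' A) \<Longrightarrow> subset_expectation q K h = subset_expectation q K h'"
  unfolding subset_expectation_def by (intro sum.cong) auto

lemma subset_expectation_cmult:
  "subset_expectation q K (\<lambda>A. c * h A) = c * subset_expectation q K h"
  unfolding subset_expectation_def sum_distrib_left by (simp add: ac_simps)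

lemma subset_expectation_add:
  "subset_expectation q K (\<lambda>A. h A + h' A) = subset_expectation q K h + subset_expectation q K h'"
  unfolding subset_expectation_def by (simp add: sum.distrib distrib_left)

lemma subset_expectation_sum:
  "subset_expectation q K (\<lambda>A. \<Sum>l\<in>L. h l A) = (\<Sum>l\<in>L. subset_expectation q K (h l))"
  unfolding subset_expectation_def sum_distrib_left by (rule sum.swap)

lemma subset_expectation_const:
  assumes "finite K"
  shows "subset_expectation q K (\<lambda>_. c) = c"
  using assms by (induction K) (simp_all add: subset_expectation_insert algebra_simps)

lemma subset_expectation_card:
  assumes "finite K"
  shows "subset_expectation q K (\<lambda>A. real (card A)) = (\<Sum>j\<in>K. q j)"
  using assms
proof (induction K)
  case (insert k K)
  have "subset_expectation q K (\<lambda>A. real (card (insert k A))) =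
      subset_expectation q K (\<lambda>A. real (card A) + 1)"
    using insert finite_subset[of _ K]
    by (intro subset_expectation_cong) (auto simp: card_insert_if)
  then show ?case
    using insert
    by (simp add: subset_expectation_insert subset_expectation_add subset_expectation_const
        algebra_simps)
qed simp

text \<open>A random subset of a disjoint union is the union of two independent random subsets, so
  this is iterated expectation. Peeling an element off \<open>K\<close> gives the same recursion on
  both sides.\<close>

lemma subset_expectation_Un:
  assumes "finite K" "finite L" "K \<inter> L = {}"
  shows "subset_expectation q (K \<union> L) h =
    subset_expectation q K (\<lambda>A. subset_expectation q L (\<lambda>B. h (A \<union> B)))"
  using assms
proof (induction K arbitrary: h)
  case (insert k K)
  have "subset_expectation q (insert k K \<union> L) h = subset_expectation q (insert k (K \<union> L)) h"
    by simp
  also have "\<dots> = (1 - q k) * subset_expectation q (K \<union> L) h +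
      q k * subset_expectation q (K \<union> L) (\<lambda>A. h (insert k A))"
    using insert by (intro subset_expectation_insert) auto
  also have "\<dots> = subset_expectation q (insert k K) (\<lambda>A. subset_expectation q L (\<lambda>B. h (A \<union> B)))"
    using insert by (simp add: subset_expectation_insert)
  finally show ?case .
qed simp

text \<open>Independence of \<open>A \<inter> K\<close> and \<open>A \<inter> L\<close>, in the form
  that later separates the numerator of the gain from its denominator.\<close>

lemma subset_expectation_prod:
  assumes "finite K" "finite L" "K \<inter> L = {}"
  shows "subset_expectation q (K \<union> L) (\<lambda>A. u (A \<inter> K) * v (A \<inter> L)) =
    subset_expectation q K u * subset_expectation q L v"
proof -
  have "subset_expectation q (K \<union> L) (\<lambda>A. u (A \<inter> K) * v (A \<inter> L)) =
     subset_expectation q K (\<lambda>A. subset_expectation q L (\<lambda>B. u ((A \<union> B) \<inter> K) * v ((A \<union> B) \<inter> L)))"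
    using assms by (rule subset_expectation_Un)
  also have "\<dots> = subset_expectation q K (\<lambda>A. subset_expectation q L (\<lambda>B. u A * v B))"
  proof (intro subset_expectation_cong)
    fix A B assume "A \<subseteq> K" "B \<subseteq> L"
    then have "(A \<union> B) \<inter> K = A" "(A \<union> B) \<inter> L = B" using assms by auto
    then show "u ((A \<union> B) \<inter> K) * v ((A \<union> B) \<inter> L) = u A * v B" by simp
  qed
  finally show ?thesis
    by (simp add: subset_expectation_cmult mult.commute[of _ "subset_expectation q L v"])
qed

lemma subset_expectation_pos:
  assumes "finite K" "\<And>j. j \<in> K \<Longrightarrow> 0 \<le> q j \<and> q j \<le> 1" "\<And>A. A \<subseteq> K \<Longrightarrow> 0 < h A"
  shows "0 < subset_expectation q K h"
  using assms
proof (induction K arbitrary: h)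
  case (insert k K)
  have "0 < subset_expectation q K h" "0 < subset_expectation q K (\<lambda>A. h (insert k A))"
    using insert.prems by (auto intro!: insert.IH insert.prems(2) simp: subset_insertI2)
  moreover have "0 \<le> q k" "q k \<le> 1" using insert.prems by auto
  \<comment> \<open>The value is a convex combination of two positive numbers. Either weight may
    vanish: for \<open>q k = 0\<close> the first term is everything, otherwise the second is
    positive.\<close>
  ultimately show ?case
    unfolding subset_expectation_insert[OF insert.hyps]
    by (cases "q k = 0") (auto intro!: add_nonneg_pos)
qed simp

text \<open>Links the polynomial sum to the probabilistic definition by identifying an outcome
  \<open>b\<close> with the set where it is true. The bounds on \<open>q\<close> keep
  \<open>bernoulli_pmf\<close> from truncating its parameter.\<close>

lemma bernoulli_vec_expectation:
  fixes q :: "real ^ 'n"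
  assumes "\<And>j. 0 \<le> q $ j \<and> q $ j \<le> 1"
  shows "measure_pmf.expectation (bernoulli_vec q) (\<lambda>b. h {j. b j}) =
    subset_expectation (($) q) UNIV h"
proof -
  have pmf: "pmf (bernoulli_vec q) (\<lambda>j. j \<in> T) = (\<Prod>j\<in>T. q $ j) * (\<Prod>j\<in>UNIV - T. 1 - q $ j)" for T
  proof -
    have "pmf (bernoulli_vec q) (\<lambda>j. j \<in> T) = (\<Prod>j\<in>UNIV. if j \<in> T then q $ j else 1 - q $ j)"
      unfolding bernoulli_vec_def using assms
      by (subst pmf_Pi') (auto intro!: prod.cong)
    also have "\<dots> = (\<Prod>j\<in>UNIV \<inter> T. q $ j) * (\<Prod>j\<in>UNIV \<inter> - T. 1 - q $ j)"
      by (subst prod.If_cases) (auto simp: Collect_mem_eq Compl_eq)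
    finally show ?thesis by (simp add: Compl_eq_Diff_UNIV)
  qed
  have "measure_pmf.expectation (bernoulli_vec q) (\<lambda>b. h {j. b j}) =
      (\<Sum>b\<in>UNIV. h {j. b j} * pmf (bernoulli_vec q) b)"
    by (subst integral_measure_pmf[where A = UNIV]) (auto simp: mult.commute)
  also have "\<dots> = (\<Sum>T\<in>UNIV. h T * pmf (bernoulli_vec q) (\<lambda>j. j \<in> T))"
    by (rule sum.reindex_bij_witness[of _ "\<lambda>T j. j \<in> T" Collect]) auto
  finally show ?thesis
    by (simp add: subset_expectation_def pmf mult.commute)
qed

subsection \<open>The conditional gain of a predicted set\<close>

text \<open>\<open>S\<close> is the predicted set and \<open>T\<close> the true one. The size of
  their union is written so that the numerator depends on \<open>T\<close> only through
  \<open>S \<inter> T\<close> and the denominator only through \<open>T - S\<close>.\<close>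

definition iou_ratio :: "real \<Rightarrow> 'i set \<Rightarrow> 'i set \<Rightarrow> real" where
  "iou_ratio \<gamma> S T = (real (card (S \<inter> T)) + \<gamma>) / (real (card S) + real (card (T - S)) + \<gamma>)"

definition iou_value :: "real \<Rightarrow> real ^ 'n \<Rightarrow> 'n set \<Rightarrow> real" where
  "iou_value \<gamma> q S = subset_expectation (($) q) UNIV (iou_ratio \<gamma> S)"

lemma iou_value_factor:
  fixes q :: "real ^ 'n"
  shows "iou_value \<gamma> q S = ((\<Sum>j\<in>S. q $ j) + \<gamma>) *
    subset_expectation (($) q) (- S) (\<lambda>B. 1 / (real (card S) + real (card B) + \<gamma>))"
proof -
  have "iou_value \<gamma> q S = subset_expectation (($) q) (S \<union> - S)
      (\<lambda>A. (\<lambda>B. real (card B) + \<gamma>) (A \<inter> S) * (\<lambda>B. 1 / (real (card S) + real (card B) + \<gamma>)) (A \<inter> - S))"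
    unfolding iou_value_def
    by (auto intro!: subset_expectation_cong simp: iou_ratio_def Int_commute Diff_eq)
  also have "\<dots> = subset_expectation (($) q) S (\<lambda>B. real (card B) + \<gamma>) *
      subset_expectation (($) q) (- S) (\<lambda>B. 1 / (real (card S) + real (card B) + \<gamma>))"
    by (rule subset_expectation_prod) auto
  finally show ?thesis
    by (simp add: subset_expectation_add subset_expectation_card subset_expectation_const)
qed

text \<open>The expectation of the reciprocal is grouped by the number \<open>l\<close> of positives
  outside the top set. The cardinality hypothesis matters because ties can make
  \<open>top_set q \<tau>\<close> smaller than \<open>\<tau>\<close>.\<close>

lemma volume_objective_eq:
  fixes q :: "real ^ 'n"
  assumes q: "\<And>j. 0 \<le> q $ j \<and> q $ j \<le> 1" and card: "card (top_set q \<tau>) = \<tau>"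
  shows "volume_objective \<gamma> q \<tau> = iou_value \<gamma> q (top_set q \<tau>)"
proof -
  let ?S = "top_set q \<tau>"
  let ?K = "- ?S"
  have cardK: "card ?K = CARD('n) - \<tau>"
    using card by (simp add: Compl_eq_Diff_UNIV card_Diff_subset)
  have prob: "measure_pmf.prob (bernoulli_vec q) {b. (\<Sum>j\<in>?K. of_bool (b j)) = l} =
      subset_expectation (($) q) UNIV (\<lambda>A. of_bool (card (A \<inter> ?K) = l))" for l :: nat
  proof -
    have "(\<Sum>j\<in>?K. of_bool (b j)) = card ({j. b j} \<inter> ?K)" for b
      by (simp add: of_bool_def sum.If_cases Int_commute)
    then have "measure_pmf.prob (bernoulli_vec q) {b. (\<Sum>j\<in>?K. of_bool (b j)) = l} =
      measure_pmf.expectation (bernoulli_vec q) (indicator {b. card ({j. b j} \<inter> ?K) = l})"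
      by simp
    also have "\<dots> = measure_pmf.expectation (bernoulli_vec q)
        (\<lambda>b. of_bool (card ({j. b j} \<inter> ?K) = l))"
      by (intro Bochner_Integration.integral_cong) (auto simp: indicator_def)
    finally show ?thesis
      using bernoulli_vec_expectation[OF q] by simp
  qed
  have "(\<Sum>l = 0..CARD('n) - \<tau>. 1 / (real \<tau> + real l + \<gamma>) *
       measure_pmf.prob (bernoulli_vec q) {b. (\<Sum>j\<in>?K. of_bool (b j)) = l}) =
    subset_expectation (($) q) UNIV
      (\<lambda>A. \<Sum>l = 0..CARD('n) - \<tau>. 1 / (real \<tau> + real l + \<gamma>) * of_bool (card (A \<inter> ?K) = l))"
    unfolding prob subset_expectation_sum by (simp only: subset_expectation_cmult)
  \<comment> \<open>For each \<open>A\<close> a single \<open>l\<close> survives in the sum. The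
    constant factor on \<open>?S\<close> is inserted so that the product rule integrates these
    coordinates out.\<close>
  also have "\<dots> = subset_expectation (($) q) (?S \<union> ?K)
      (\<lambda>A. (\<lambda>_. 1) (A \<inter> ?S) * (\<lambda>B. 1 / (real (card ?S) + real (card B) + \<gamma>)) (A \<inter> ?K))"
  proof -
    \<comment> \<open>The surviving index never exceeds the upper limit of the sum.\<close>
    have "card (A \<inter> ?K) \<le> CARD('n) - \<tau>" for A
      unfolding cardK[symmetric] by (rule card_mono) auto
    then show ?thesis
      by (auto intro!: subset_expectation_cong simp: card of_bool_def if_distrib sum.delta cong: if_cong)
  qed
  also have "\<dots> = subset_expectation (($) q) ?K (\<lambda>B. 1 / (real (card ?S) + real (card B) + \<gamma>))"
    by (subst subset_expectation_prod) (auto simp: subset_expectation_const)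
  finally show ?thesis
    by (simp add: volume_objective_def iou_value_factor)
qed

section \<open>Exchange argument and sets of the most probable coordinates\<close>

text \<open>The two complements differ only in \<open>k\<close> versus \<open>i\<close> and share
  the rest \<open>R\<close>. Splitting off this one coordinate makes both gains explicit in
  \<open>q $ i\<close>, \<open>q $ k\<close> and common quantities.\<close>

lemma iou_value_exchange:
  fixes q :: "real ^ 'n"
  assumes q: "\<And>j. 0 \<le> q $ j \<and> q $ j \<le> 1" and "0 \<le> \<gamma>"
    and ik: "i \<in> S" "k \<notin> S" "q $ i < q $ k"
  shows "iou_value \<gamma> q S < iou_value \<gamma> q (insert k (S - {i}))"
proof -
  define S' where "S' = insert k (S - {i})"
  define R where "R = - S - {k}"
  define s where "s = (\<Sum>j\<in>S - {i}. q $ j) + \<gamma>"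
  \<comment> \<open>\<open>E c\<close> is the second factor of the gain when the exchanged
    coordinate left unpredicted (\<open>k\<close> for \<open>S\<close>, \<open>i\<close> for
    \<open>S'\<close>) contributes \<open>c\<close> positives.\<close>
  define E where "E c = subset_expectation (($) q) R (\<lambda>B. 1 / (real (card S) + c + real (card B) + \<gamma>))" for c :: real
  \<comment> \<open>Since \<open>S\<close> contains \<open>i\<close>, all denominators are positive
    even for \<open>\<gamma> = 0\<close>.\<close>
  have S: "0 < card S" using ik by (auto simp: card_gt_0_iff)
  have cardS': "card S' = card S"
    using ik S by (simp add: S'_def card_insert_if)
  have step: "subset_expectation (($) q) (insert j R) (\<lambda>B. 1 / (real (card S) + real (card B) + \<gamma>)) =
      (1 - q $ j) * E 0 + q $ j * E 1" if "j \<notin> R" for j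
  proof -
    have "subset_expectation (($) q) R (\<lambda>B. 1 / (real (card S) + real (card (insert j B)) + \<gamma>)) = E 1"
      unfolding E_def using that
      by (intro subset_expectation_cong) (auto simp: card_insert_if add_ac)
    then show ?thesis
      using that by (simp add: subset_expectation_insert E_def)
  qed
  have "- S = insert k R" "- S' = insert i R" "k \<notin> R" "i \<notin> R"
    using ik by (auto simp: R_def S'_def)
  moreover have "(\<Sum>j\<in>S. q $ j) = q $ i + (\<Sum>j\<in>S - {i}. q $ j)"
    using ik by (simp add: sum.remove)
  moreover have "(\<Sum>j\<in>S'. q $ j) = q $ k + (\<Sum>j\<in>S - {i}. q $ j)"
    using ik by (simp add: S'_def)
  ultimately have val: "iou_value \<gamma> q S = (s + q $ i) * ((1 - q $ k) * E 0 + q $ k * E 1)"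
    "iou_value \<gamma> q S' = (s + q $ k) * ((1 - q $ i) * E 0 + q $ i * E 1)"
    by (simp_all add: iou_value_factor cardS' step s_def)
  have E0: "0 < E 0"
    unfolding E_def using q S \<open>0 \<le> \<gamma>\<close> by (intro subset_expectation_pos) auto
  \<comment> \<open>By linearity this is \<open>E 0 - E 1\<close>; one more positive strictly
    enlarges every denominator.\<close>
  have "0 < subset_expectation (($) q) R
      (\<lambda>B. 1 / (real (card S) + 0 + real (card B) + \<gamma>) + (- 1) * (1 / (real (card S) + 1 + real (card B) + \<gamma>)))"
    using q S \<open>0 \<le> \<gamma>\<close>
    by (intro subset_expectation_pos) (auto intro!: divide_strict_left_mono mult_pos_pos add_pos_nonneg)
  then have E1: "E 1 < E 0"
    unfolding subset_expectation_add subset_expectation_cmult E_def by simp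
  have "0 \<le> s" unfolding s_def using q \<open>0 \<le> \<gamma>\<close> by (auto intro!: add_nonneg_nonneg sum_nonneg)
  \<comment> \<open>The terms containing \<open>q $ i * q $ k\<close> cancel, which leaves the
    common factor \<open>q $ k - q $ i\<close>.\<close>
  have "iou_value \<gamma> q S' - iou_value \<gamma> q S = (q $ k - q $ i) * (s * (E 0 - E 1) + E 0)"
    unfolding val by (simp add: algebra_simps)
  also have "\<dots> > 0"
    using ik E0 E1 \<open>0 \<le> s\<close> by (intro mult_pos_pos add_nonneg_pos) auto
  finally show ?thesis by (simp add: S'_def)
qed

text \<open>The coordinates at least as probable as a member of \<open>S\<close> all lie in
  \<open>S\<close>; those at least as probable as a nonmember \<open>k\<close> include
  \<open>S\<close> and \<open>k\<close> itself, hence number more than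
  \<open>card S\<close>.\<close>

lemma top_set_unique:
  fixes q :: "real ^ 'n"
  assumes "\<And>i k. i \<in> S \<Longrightarrow> k \<notin> S \<Longrightarrow> q $ k < q $ i"
  shows "top_set q (card S) = S"
proof -
  have "card {j'. q $ j' \<ge> q $ i} \<le> card S" if "i \<in> S" for i
    using assms that by (intro card_mono) force+
  moreover have "card S < card {j'. q $ j' \<ge> q $ k}" if "k \<notin> S" for k
    using assms[OF _ that] that by (intro psubset_card_mono) (auto simp: less_imp_le)
  ultimately show ?thesis
    unfolding top_set_def by (fastforce simp: not_less[symmetric])
qed

text \<open>A strictly separated set of each size is built by adding the most probable coordinate of
  the complement; injectivity excludes ties with it. \<open>top_set_unique\<close> then identifies
  this set.\<close>

lemma card_top_set:
  fixes q :: "real ^ 'n"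
  assumes inj: "inj (($) q)" and "\<tau> \<le> CARD('n)"
  shows "card (top_set q \<tau>) = \<tau>"
proof -
  have "\<exists>S. card S = \<tau> \<and> (\<forall>i\<in>S. \<forall>k. k \<notin> S \<longrightarrow> q $ k < q $ i)"
    using \<open>\<tau> \<le> CARD('n)\<close>
  proof (induction \<tau>)
    case (Suc \<tau>)
    then obtain S where S: "card S = \<tau>" "\<And>i k. i \<in> S \<Longrightarrow> k \<notin> S \<Longrightarrow> q $ k < q $ i"
      by auto
    have "S \<noteq> UNIV" using S(1) Suc.prems by auto
    then have "- S \<noteq> {}" by auto
    then obtain m where m: "m \<in> - S" "\<And>k. k \<in> - S \<Longrightarrow> q $ k \<le> q $ m"
      using Max_in[of "($) q ` (- S)"] Max_ge[of "($) q ` (- S)"] by fastforce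
    have "q $ k < q $ i" if "i \<in> insert m S" "k \<notin> insert m S" for i k
    proof (cases "i = m")
      case True
      then have "q $ k \<le> q $ m" "q $ k \<noteq> q $ m" using m that inj by (auto dest: injD)
      then show ?thesis using True by simp
    qed (use S that in auto)
    then show ?case using S(1) m(1) by (intro exI[of _ "insert m S"]) auto
  qed auto
  then obtain S where "card S = \<tau>" "\<And>i k. i \<in> S \<Longrightarrow> k \<notin> S \<Longrightarrow> q $ k < q $ i"
    by blast
  then show ?thesis using top_set_unique[of S q] by simp
qed

lemma iou_value_maximal_iff:
  fixes q :: "real ^ 'n"
  assumes q: "\<And>j. 0 \<le> q $ j \<and> q $ j \<le> 1" and inj: "inj (($) q)" and "0 \<le> \<gamma>"
  shows "(\<forall>T. iou_value \<gamma> q T \<le> iou_value \<gamma> q S) \<longleftrightarrow>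
    (\<exists>\<tau>. is_arg_max (volume_objective \<gamma> q) (\<lambda>\<tau>. \<tau> \<in> {0..CARD('n)}) \<tau> \<and> S = top_set q \<tau>)"
proof -
  have vol: "volume_objective \<gamma> q \<tau> = iou_value \<gamma> q (top_set q \<tau>)" if "\<tau> \<le> CARD('n)" for \<tau>
    using volume_objective_eq[OF q] card_top_set[OF inj that] by simp
  \<comment> \<open>In a maximizer no exchange can be profitable, and injectivity excludes equality,
    so its members strictly dominate its nonmembers.\<close>
  have top: "top_set q (card U) = U" if "\<And>T. iou_value \<gamma> q T \<le> iou_value \<gamma> q U" for U
  proof (rule top_set_unique)
    fix i k assume "i \<in> U" "k \<notin> U"
    then have "\<not> q $ i < q $ k" "q $ i \<noteq> q $ k"
      using iou_value_exchange[OF q \<open>0 \<le> \<gamma>\<close>] that inj by (fastforce simp: not_less[symmetric] dest: injD)+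
    then show "q $ k < q $ i" by simp
  qed
  have card: "card U \<le> CARD('n)" for U :: "'n set" by (simp add: card_mono)
  show ?thesis
  proof
    assume max: "\<forall>T. iou_value \<gamma> q T \<le> iou_value \<gamma> q S"
    then have "top_set q (card S) = S" using top by blast
    then show "\<exists>\<tau>. is_arg_max (volume_objective \<gamma> q) (\<lambda>\<tau>. \<tau> \<in> {0..CARD('n)}) \<tau> \<and> S = top_set q \<tau>"
      using max card[of S] vol by (intro exI[of _ "card S"]) (auto simp: is_arg_max_def not_less)
  next
    assume "\<exists>\<tau>. is_arg_max (volume_objective \<gamma> q) (\<lambda>\<tau>. \<tau> \<in> {0..CARD('n)}) \<tau> \<and> S = top_set q \<tau>"
    then obtain \<tau> where \<tau>: "\<tau> \<le> CARD('n)" "S = top_set q \<tau>"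
      "\<And>\<sigma>. \<sigma> \<le> CARD('n) \<Longrightarrow> volume_objective \<gamma> q \<sigma> \<le> volume_objective \<gamma> q \<tau>"
      by (auto simp: is_arg_max_def not_less)
    \<comment> \<open>A global maximizer \<open>U\<close> exists because there are finitely many
      sets. It is a top set, so its gain is the objective at \<open>card U\<close>, which the
      objective at \<open>\<tau>\<close> dominates.\<close>
    have "finite (range (iou_value \<gamma> q))" by simp
    then obtain U where U: "\<And>T. iou_value \<gamma> q T \<le> iou_value \<gamma> q U"
      using Max_in[of "range (iou_value \<gamma> q)"] Max_ge[of "range (iou_value \<gamma> q)"] by fastforce
    have "iou_value \<gamma> q U \<le> iou_value \<gamma> q S"
      using \<tau>(3)[OF card[of U]] top[OF U] vol[OF card[of U]] vol[OF \<tau>(1)] \<tau>(2) by simp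
    then show "\<forall>T. iou_value \<gamma> q T \<le> iou_value \<gamma> q S" using U order_trans by blast
  qed
qed

subsection \<open>Integration over the features\<close>

definition support :: "real ^ 'n \<Rightarrow> 'n set" where
  "support y = {j. y $ j = 1}"

lemma measurable_support [measurable]: "(support :: real ^ 'n \<Rightarrow> 'n set) \<in> borel \<rightarrow>\<^sub>M count_space UNIV"
proof -
  have "(support :: real ^ 'n \<Rightarrow> 'n set) -` {T} \<inter> space borel \<in> sets borel" for T
  proof -
    have "support -` {T} \<inter> space borel = {y :: real ^ 'n \<in> space borel. \<forall>j. (y $ j = 1) = (j \<in> T)}"
      by (auto simp: support_def)
    also have "\<dots> \<in> sets borel" by measurable
    finally show ?thesis .
  qed
  then show ?thesis
    by (subst measurable_count_space_eq2) auto
qed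

text \<open>Inclusion-exclusion for the union. The two quotients agree term by term, so the
  convention for 0/0 carries over.\<close>

lemma binary_cube_iou_ratio:
  fixes y d :: "real ^ 'n"
  assumes "y \<in> binary_cube" "d \<in> binary_cube"
  shows "(y \<bullet> d + \<gamma>) / (l1_norm y + l1_norm d - y \<bullet> d + \<gamma>) = iou_ratio \<gamma> (support d) (support y)"
proof -
  have coord: "y $ j = of_bool (j \<in> support y)" "d $ j = of_bool (j \<in> support d)" for j
    using assms by (auto simp: binary_cube_def support_def)
  have "y \<bullet> d = real (card (support d \<inter> support y))"
    by (simp add: inner_vec_def coord Int_def conj_commute)
  moreover have "l1_norm y = real (card (support y))" "l1_norm d = real (card (support d))"
    unfolding l1_norm_def by (simp_all add: coord)
  moreover have "real (card (support y)) =
      real (card (support d \<inter> support y)) + real (card (support y - support d))"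
    by (subst card_Int_Diff[where B = "support d"]) (auto simp: Int_commute)
  ultimately show ?thesis by (simp add: iou_ratio_def algebra_simps)
qed

lemma measurable_vec_nth [measurable (raw)]:
  "f \<in> borel_measurable N \<Longrightarrow> (\<lambda>x. (f x :: real ^ 'n) $ j) \<in> borel_measurable N"
  by (rule measurable_compose[OF _ borel_measurable_nth])

lemma iou_value_measurable [measurable]: "(\<lambda>q :: real ^ 'n. iou_value \<gamma> q S) \<in> borel_measurable borel"
  unfolding iou_value_def subset_expectation_def by measurable

text \<open>The predicted set takes finitely many values, and for each fixed set the gain is a
  polynomial in \<open>p x\<close>.\<close>

lemma iou_value_support_measurable:
  fixes p \<delta> :: "real ^ 'n \<Rightarrow> real ^ 'n"
  assumes [measurable]: "p \<in> borel_measurable borel" "\<delta> \<in> borel_measurable borel"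
  shows "(\<lambda>x. iou_value \<gamma> (p x) (support (\<delta> x))) \<in> borel_measurable borel"
  by (rule measurable_compose_countable'[where I = UNIV and g = "\<lambda>x. support (\<delta> x)"])
    (auto intro: countable_finite)

section \<open>Conditional law of the labels given the features\<close>

locale segmentation_model = prob_space M
  for M :: "'a measure" and X Y :: "'a \<Rightarrow> real ^ 'n" and p :: "real ^ 'n \<Rightarrow> real ^ 'n" +
  assumes X [measurable]: "X \<in> borel_measurable M"
    and Y [measurable]: "Y \<in> borel_measurable M"
    and cube: "\<And>\<omega>. \<omega> \<in> space M \<Longrightarrow> Y \<omega> \<in> binary_cube"
    and indep: "cond_indep_vars M (sigma_gen M X) (\<lambda>_. borel) (\<lambda>j \<omega>. Y \<omega> $ j) UNIV"
    and p [measurable]: "p \<in> borel_measurable borel"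
    and cond_prob: "\<And>j. AE \<omega> in M. p (X \<omega>) $ j =
           cond_prob_given M (sigma_gen M X) {\<omega>' \<in> space M. Y \<omega>' $ j = 1} \<omega>"
begin

lemma subalgebra_sigma_gen: "subalgebra M (sigma_gen M X)"
  unfolding subalgebra_def sigma_gen_def
  using measurable_iff_sets[of X M borel] X by (auto simp: space_vimage_algebra)

sublocale finite_measure_subalgebra M "sigma_gen M X"
  by unfold_locales (rule subalgebra_sigma_gen)

lemma X_sigma_gen [measurable]: "X \<in> borel_measurable (sigma_gen M X)"
  unfolding sigma_gen_def by (rule measurable_vimage_algebra1) auto

text \<open>\<open>p\<close> is only a version of the conditional probabilities, so it inherits the
  bounds of an indicator only almost everywhere.\<close>

lemma cond_prob_bounds: "AE \<omega> in M. \<forall>j. 0 \<le> p (X \<omega>) $ j \<and> p (X \<omega>) $ j \<le> 1"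
proof -
  have "AE \<omega> in M. 0 \<le> p (X \<omega>) $ j \<and> p (X \<omega>) $ j \<le> 1" for j
  proof -
    let ?f = "indicator {\<omega>' \<in> space M. Y \<omega>' $ j = 1} :: 'a \<Rightarrow> real"
    have "integrable M ?f"
      by (intro integrable_const_bound[where B = 1]) auto
    then have "AE \<omega> in M. 0 \<le> real_cond_exp M (sigma_gen M X) ?f \<omega>"
      "AE \<omega> in M. real_cond_exp M (sigma_gen M X) ?f \<omega> \<le> 1"
      by (auto intro!: real_cond_exp_ge_c real_cond_exp_le_c)
    with cond_prob[of j] show ?thesis
      unfolding cond_prob_given_def by eventually_elim auto
  qed
  then show ?thesis by (simp add: AE_all_countable)
qed

text \<open>On the binary cube the indicators of label 0 and label 1 sum to 1; conditional
  expectation is linear.\<close>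

lemma cond_prob_compl:
  "AE \<omega> in M. cond_prob_given M (sigma_gen M X) {\<omega>' \<in> space M. Y \<omega>' $ j = 0} \<omega> = 1 - p (X \<omega>) $ j"
proof -
  let ?f = "\<lambda>c. indicator {\<omega>' \<in> space M. Y \<omega>' $ j = c} :: 'a \<Rightarrow> real"
  have [measurable]: "?f c \<in> borel_measurable M" for c by measurable
  have int: "integrable M (?f c)" for c
    by (intro integrable_const_bound[where B = 1]) auto
  have "AE \<omega> in M. ?f 0 \<omega> = 1 - ?f 1 \<omega>"
    using cube by (intro AE_I2) (auto simp: indicator_def binary_cube_def)
  then have "AE \<omega> in M. real_cond_exp M (sigma_gen M X) (?f 0) \<omega> =
      real_cond_exp M (sigma_gen M X) (\<lambda>\<omega>. 1 - ?f 1 \<omega>) \<omega>"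
    by (rule real_cond_exp_cong) auto
  moreover have "AE \<omega> in M. real_cond_exp M (sigma_gen M X) (\<lambda>\<omega>. 1 - ?f 1 \<omega>) \<omega> =
      real_cond_exp M (sigma_gen M X) (\<lambda>_. 1) \<omega> - real_cond_exp M (sigma_gen M X) (?f 1) \<omega>"
    using int by (intro real_cond_exp_diff) auto
  moreover have "AE \<omega> in M. real_cond_exp M (sigma_gen M X) (\<lambda>_. 1) \<omega> = 1"
    by (rule real_cond_exp_F_meas) auto
  ultimately show ?thesis
    using cond_prob[of j] unfolding cond_prob_given_def by eventually_elim simp
qed

lemma cond_prob_support:
  "AE \<omega> in M. cond_prob_given M (sigma_gen M X) {\<omega>' \<in> space M. support (Y \<omega>') = T} \<omega> =
    (\<Prod>j\<in>T. p (X \<omega>) $ j) * (\<Prod>j\<in>UNIV - T. 1 - p (X \<omega>) $ j)"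
proof -
  \<comment> \<open>These singletons make the event \<open>support (Y \<omega>') = T\<close> a
    product event, to which conditional independence applies with all coordinates at once.\<close>
  let ?A = "\<lambda>j. {if j \<in> T then 1 else 0 :: real}"
  have law: "AE \<omega> in M.
      cond_prob_given M (sigma_gen M X) {\<omega>' \<in> space M. \<forall>j\<in>UNIV. Y \<omega>' $ j \<in> ?A j} \<omega> =
      (\<Prod>j\<in>UNIV. cond_prob_given M (sigma_gen M X) {\<omega>' \<in> space M. Y \<omega>' $ j \<in> ?A j} \<omega>)"
    by (rule indep[unfolded cond_indep_vars_def, THEN conjunct2, rule_format]) auto
  have marginals: "AE \<omega> in M. \<forall>j. cond_prob_given M (sigma_gen M X) {\<omega>' \<in> space M. Y \<omega>' $ j \<in> ?A j} \<omega> =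
      (if j \<in> T then p (X \<omega>) $ j else 1 - p (X \<omega>) $ j)"
    unfolding AE_all_countable
  proof
    fix j
    show "AE \<omega> in M. cond_prob_given M (sigma_gen M X) {\<omega>' \<in> space M. Y \<omega>' $ j \<in> ?A j} \<omega> =
        (if j \<in> T then p (X \<omega>) $ j else 1 - p (X \<omega>) $ j)"
      using cond_prob[of j] cond_prob_compl[of j] by eventually_elim auto
  qed
  have event: "{\<omega>' \<in> space M. \<forall>j\<in>UNIV. Y \<omega>' $ j \<in> ?A j} = {\<omega>' \<in> space M. support (Y \<omega>') = T}"
    using cube by (fastforce simp: support_def binary_cube_def split: if_splits)
  have "AE \<omega> in M.
      cond_prob_given M (sigma_gen M X) {\<omega>' \<in> space M. support (Y \<omega>') = T} \<omega> =
      (\<Prod>j\<in>UNIV. if j \<in> T then p (X \<omega>) $ j else 1 - p (X \<omega>) $ j)"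
    using law[unfolded event] marginals by eventually_elim (simp only:)
  then show ?thesis
    by (simp add: prod.If_cases Collect_mem_eq Compl_eq_Diff_UNIV)
qed

text \<open>The predicted set is a function of \<open>X\<close>, so its indicator is measurable for
  \<open>sigma_gen M X\<close> and can be pulled out of the conditional expectation of the event
  \<open>support (Y \<omega>) = T\<close>.\<close>

lemma integrable_joint_weight:
  fixes \<delta> :: "real ^ 'n \<Rightarrow> real ^ 'n"
  assumes [measurable]: "\<delta> \<in> borel_measurable borel"
  shows "integrable M (\<lambda>\<omega>. indicator {x. support (\<delta> x) = S} (X \<omega>) *
      ((\<Prod>j\<in>T. p (X \<omega>) $ j) * (\<Prod>j\<in>UNIV - T. 1 - p (X \<omega>) $ j)))" (is ?int)
    and "measure M {\<omega> \<in> space M. support (\<delta> (X \<omega>)) = S \<and> support (Y \<omega>) = T} =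
    (\<integral>\<omega>. indicator {x. support (\<delta> x) = S} (X \<omega>) *
      ((\<Prod>j\<in>T. p (X \<omega>) $ j) * (\<Prod>j\<in>UNIV - T. 1 - p (X \<omega>) $ j)) \<partial>M)" (is ?eq)
proof -
  let ?D = "{x. support (\<delta> x) = S}"
  let ?f = "indicator {\<omega>' \<in> space M. support (Y \<omega>') = T} :: 'a \<Rightarrow> real"
  let ?c = "real_cond_exp M (sigma_gen M X) ?f"
  have D: "?D \<in> sets borel"
    using measurable_sets[OF measurable_compose[OF assms measurable_support], of "{S}"]
    by (simp add: vimage_def)
  then have ind: "(\<lambda>\<omega>. indicator ?D (X \<omega>) :: real) \<in> borel_measurable (sigma_gen M X)"
    by measurable
  have [measurable]: "(\<lambda>\<omega>. indicator ?D (X \<omega>) :: real) \<in> borel_measurable M"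
    using D by measurable
  have f [measurable]: "?f \<in> borel_measurable M" by measurable
  have int: "integrable M (\<lambda>\<omega>. indicator ?D (X \<omega>) * ?f \<omega>)"
    by (intro integrable_const_bound[where B = 1]) (auto simp: indicator_def)
  \<comment> \<open>This yields both integrability and the equality of integrals; \<open>ae\<close>
    then replaces the conditional expectation by the product weight.\<close>
  note * = real_cond_exp_intg[OF int ind f]
  have ae: "AE \<omega> in M. indicator ?D (X \<omega>) * ?c \<omega> = indicator ?D (X \<omega>) *
      ((\<Prod>j\<in>T. p (X \<omega>) $ j) * (\<Prod>j\<in>UNIV - T. 1 - p (X \<omega>) $ j))"
    using cond_prob_support[of T] unfolding cond_prob_given_def by eventually_elim simp
  show ?int
    using * ae by (subst integrable_cong_AE[symmetric, OF _ _ ae]) auto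
  have "measure M {\<omega> \<in> space M. support (\<delta> (X \<omega>)) = S \<and> support (Y \<omega>) = T} =
      (\<integral>\<omega>. indicator {\<omega> \<in> space M. support (\<delta> (X \<omega>)) = S \<and> support (Y \<omega>) = T} \<omega> \<partial>M)"
    by simp
  also have "\<dots> = (\<integral>\<omega>. indicator ?D (X \<omega>) * ?f \<omega> \<partial>M)"
    by (intro Bochner_Integration.integral_cong) (auto simp: indicator_def)
  also have "\<dots> = (\<integral>\<omega>. indicator ?D (X \<omega>) * ?c \<omega> \<partial>M)"
    using *(2) by simp
  finally show ?eq
    using integral_cong_AE[OF _ _ ae] by simp
qed

section \<open>The criterion as an integral of pointwise gains\<close>

lemma iou_value_expand:
  "iou_value \<gamma> (p x) (support (\<delta> x)) = (\<Sum>S\<in>UNIV. \<Sum>T\<in>UNIV. iou_ratio \<gamma> S T *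
    (indicator {x. support (\<delta> x) = S} x * ((\<Prod>j\<in>T. p x $ j) * (\<Prod>j\<in>UNIV - T. 1 - p x $ j))))"
proof -
  have "(\<Sum>T\<in>UNIV. iou_ratio \<gamma> S T *
      (indicator {x. support (\<delta> x) = S} x * ((\<Prod>j\<in>T. p x $ j) * (\<Prod>j\<in>UNIV - T. 1 - p x $ j)))) =
    (if support (\<delta> x) = S then iou_value \<gamma> (p x) S else 0)" for S
    by (cases "support (\<delta> x) = S") (simp_all add: iou_value_def subset_expectation_def mult_ac)
  then show ?thesis by simp
qed

text \<open>Predicted and true sets range over finitely many pairs \<open>S\<close>,
  \<open>T\<close>. Both integrals therefore become the same finite sum of
  \<open>iou_ratio \<gamma> S T\<close> times the probability of that pair.\<close>

lemma
  assumes "\<delta> \<in> segmentation_rules"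
  shows integrable_iou_value: "integrable M (\<lambda>\<omega>. iou_value \<gamma> (p (X \<omega>)) (support (\<delta> (X \<omega>))))"
    and IoU_eq_iou_value: "IoU M X Y \<gamma> \<delta> = (\<integral>\<omega>. iou_value \<gamma> (p (X \<omega>)) (support (\<delta> (X \<omega>))) \<partial>M)"
proof -
  have \<delta> [measurable]: "\<delta> \<in> borel_measurable borel" and "\<And>x. \<delta> x \<in> binary_cube"
    using assms by (auto simp: segmentation_rules_def)
  show "integrable M (\<lambda>\<omega>. iou_value \<gamma> (p (X \<omega>)) (support (\<delta> (X \<omega>))))"
    unfolding iou_value_expand
    by (intro Bochner_Integration.integrable_sum integrable_mult_right integrable_joint_weight \<delta>)
  let ?E = "\<lambda>S T. {\<omega> \<in> space M. support (\<delta> (X \<omega>)) = S \<and> support (Y \<omega>) = T}"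
  have split: "(\<Sum>S\<in>UNIV. \<Sum>T\<in>UNIV. iou_ratio \<gamma> S T * indicator (?E S T) \<omega>) =
      iou_ratio \<gamma> (support (\<delta> (X \<omega>))) (support (Y \<omega>))" if "\<omega> \<in> space M" for \<omega>
  proof -
    have "(\<Sum>S\<in>UNIV. \<Sum>T\<in>UNIV. iou_ratio \<gamma> S T * indicator (?E S T) \<omega>) =
      (\<Sum>S\<in>UNIV. if support (\<delta> (X \<omega>)) = S then
        (\<Sum>T\<in>UNIV. if support (Y \<omega>) = T then iou_ratio \<gamma> S T else 0) else 0)"
      using that by (intro sum.cong) (auto simp: indicator_def intro!: sum.cong)
    then show ?thesis by simp
  qed
  have "IoU M X Y \<gamma> \<delta> = (\<integral>\<omega>. (\<Sum>S\<in>UNIV. \<Sum>T\<in>UNIV. iou_ratio \<gamma> S T * indicator (?E S T) \<omega>) \<partial>M)"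
    unfolding IoU_def using cube \<open>\<And>x. \<delta> x \<in> binary_cube\<close>
    by (intro Bochner_Integration.integral_cong refl) (simp only: split binary_cube_iou_ratio)
  also have "\<dots> = (\<Sum>S\<in>UNIV. \<Sum>T\<in>UNIV. iou_ratio \<gamma> S T * measure M (?E S T))"
  proof -
    have int: "integrable M (\<lambda>\<omega>. indicator (?E S T) \<omega> :: real)" for S T
      by (intro integrable_const_bound[where B = 1]) auto
    have "(\<integral>\<omega>. (\<Sum>S\<in>UNIV. \<Sum>T\<in>UNIV. iou_ratio \<gamma> S T * indicator (?E S T) \<omega>) \<partial>M) =
        (\<Sum>S\<in>UNIV. \<integral>\<omega>. (\<Sum>T\<in>UNIV. iou_ratio \<gamma> S T * indicator (?E S T) \<omega>) \<partial>M)"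
      by (intro Bochner_Integration.integral_sum Bochner_Integration.integrable_sum
          integrable_mult_right int)
    also have "\<dots> = (\<Sum>S\<in>UNIV. \<Sum>T\<in>UNIV. \<integral>\<omega>. iou_ratio \<gamma> S T * indicator (?E S T) \<omega> \<partial>M)"
      by (intro sum.cong refl Bochner_Integration.integral_sum integrable_mult_right int)
    finally show ?thesis by simp
  qed
  also have "\<dots> = (\<integral>\<omega>. iou_value \<gamma> (p (X \<omega>)) (support (\<delta> (X \<omega>))) \<partial>M)"
    unfolding iou_value_expand using integrable_joint_weight(1)[OF \<delta>]
    by (simp add: Bochner_Integration.integral_sum integrable_joint_weight(2)[OF \<delta>])
  finally show "IoU M X Y \<gamma> \<delta> = (\<integral>\<omega>. iou_value \<gamma> (p (X \<omega>)) (support (\<delta> (X \<omega>))) \<partial>M)" .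
qed

lemma IoU_maximal_iff:
  assumes \<delta>: "\<delta> \<in> segmentation_rules"
  shows "is_arg_max (IoU M X Y \<gamma>) (\<lambda>\<delta>. \<delta> \<in> segmentation_rules) \<delta> \<longleftrightarrow>
    (AE \<omega> in M. \<forall>T. iou_value \<gamma> (p (X \<omega>)) T \<le> iou_value \<gamma> (p (X \<omega>)) (support (\<delta> (X \<omega>))))"
    (is "_ \<longleftrightarrow> ?pointwise")
proof
  let ?V = "\<lambda>\<delta> x. iou_value \<gamma> (p x) (support (\<delta> x))"
  assume max: "is_arg_max (IoU M X Y \<gamma>) (\<lambda>\<delta>. \<delta> \<in> segmentation_rules) \<delta>"
  have [measurable]: "\<delta> \<in> borel_measurable borel" using \<delta> by (simp add: segmentation_rules_def)
  have "AE \<omega> in M. iou_value \<gamma> (p (X \<omega>)) T \<le> ?V \<delta> (X \<omega>)" for T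
  proof -
    \<comment> \<open>Predicting the fixed set T wherever it beats \<delta> is again a measurable rule, so no
      measurable selection of a pointwise maximizer is needed.\<close>
    define t :: "real ^ 'n" where "t = (\<chi> j. of_bool (j \<in> T))"
    define \<eta> where "\<eta> x = (if ?V \<delta> x < iou_value \<gamma> (p x) T then t else \<delta> x)" for x
    have "support t = T" by (simp add: support_def t_def)
    have [measurable]: "?V \<delta> \<in> borel_measurable borel"
      by (rule iou_value_support_measurable) measurable
    have "\<eta> \<in> borel_measurable borel" unfolding \<eta>_def by measurable
    moreover have "t \<in> binary_cube" by (simp add: t_def binary_cube_def)
    ultimately have \<eta>: "\<eta> \<in> segmentation_rules"
      using \<delta> by (auto simp: segmentation_rules_def \<eta>_def)
    \<comment> \<open>The improvement is the positive part of the advantage of \<open>T\<close>. It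
      is nonnegative, and by optimality its integral is at most 0, so it vanishes almost
      everywhere.\<close>
    have gain: "?V \<eta> x - ?V \<delta> x = max 0 (iou_value \<gamma> (p x) T - ?V \<delta> x)" for x
      by (simp add: \<eta>_def \<open>support t = T\<close>)
    have int: "integrable M (\<lambda>\<omega>. ?V \<eta> (X \<omega>) - ?V \<delta> (X \<omega>))"
      using integrable_iou_value[OF \<eta>] integrable_iou_value[OF \<delta>] by simp
    have "(\<integral>\<omega>. ?V \<eta> (X \<omega>) - ?V \<delta> (X \<omega>) \<partial>M) \<le> 0"
      using max \<eta> integrable_iou_value[OF \<eta>] integrable_iou_value[OF \<delta>]
      by (auto simp: is_arg_max_def not_less IoU_eq_iou_value \<delta>)
    moreover have "0 \<le> (\<integral>\<omega>. ?V \<eta> (X \<omega>) - ?V \<delta> (X \<omega>) \<partial>M)"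
      unfolding gain by simp
    ultimately have "(\<integral>\<omega>. ?V \<eta> (X \<omega>) - ?V \<delta> (X \<omega>) \<partial>M) = 0"
      by simp
    then have "AE \<omega> in M. ?V \<eta> (X \<omega>) - ?V \<delta> (X \<omega>) = 0"
      by (subst integral_nonneg_eq_0_iff_AE[OF int, symmetric]) (auto simp: gain)
    then show ?thesis
      unfolding gain by eventually_elim (simp add: max_def split: if_splits)
  qed
  \<comment> \<open>There are finitely many sets \<open>T\<close>, so the exceptional null sets can
    be united.\<close>
  then show ?pointwise by (simp add: AE_all_countable)
next
  assume ?pointwise
  then have "IoU M X Y \<gamma> \<eta> \<le> IoU M X Y \<gamma> \<delta>" if "\<eta> \<in> segmentation_rules" for \<eta>
    unfolding IoU_eq_iou_value[OF that] IoU_eq_iou_value[OF \<delta>]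
    by (intro integral_mono_AE integrable_iou_value that \<delta>) auto
  then show "is_arg_max (IoU M X Y \<gamma>) (\<lambda>\<delta>. \<delta> \<in> segmentation_rules) \<delta>"
    using \<delta> by (auto simp: is_arg_max_def not_less)
qed

end

theorem lemma13:
  fixes M :: "'a measure"
    and X Y :: "'a \<Rightarrow> real ^ 'n"
    and p \<delta>_opt :: "real ^ 'n \<Rightarrow> real ^ 'n"
    and \<gamma> :: real
  assumes "prob_space M"
    and "0 \<le> \<gamma>"
    and "X \<in> borel_measurable M"
    and "Y \<in> borel_measurable M"
    and "\<And>\<omega>. \<omega> \<in> space M \<Longrightarrow> Y \<omega> \<in> binary_cube"
    and "cond_indep_vars M (sigma_gen M X) (\<lambda>_. borel) (\<lambda>j \<omega>. Y \<omega> $ j) UNIV"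
    and "p \<in> borel_measurable borel"
    and "\<And>j. AE \<omega> in M. p (X \<omega>) $ j =
           cond_prob_given M (sigma_gen M X) {\<omega>' \<in> space M. Y \<omega>' $ j = 1} \<omega>"
    and "AE \<omega> in M. inj (\<lambda>j. p (X \<omega>) $ j)"
    and "\<delta>_opt \<in> segmentation_rules"
  shows "is_arg_max (IoU M X Y \<gamma>) (\<lambda>\<delta>. \<delta> \<in> segmentation_rules) \<delta>_opt \<longleftrightarrow>
    (AE x in distr M borel X.
      \<exists>\<tau>. is_arg_max (volume_objective \<gamma> (p x)) (\<lambda>\<tau>. \<tau> \<in> {0..CARD('n)}) \<tau> \<and>
          (\<forall>j. \<delta>_opt x $ j = (if j \<in> top_set (p x) \<tau> then 1 else 0)))"
proof -
  interpret prob_space M by fact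
  interpret segmentation_model M X Y p
    using assms(3-8) by unfold_locales
  note [measurable] = assms(3,7)
  have [measurable]: "\<delta>_opt \<in> borel_measurable borel"
    and cube: "\<And>x. \<delta>_opt x \<in> binary_cube"
    using \<open>\<delta>_opt \<in> segmentation_rules\<close> by (auto simp: segmentation_rules_def)
  let ?V = "\<lambda>x. iou_value \<gamma> (p x) (support (\<delta>_opt x))"
  have [measurable]: "?V \<in> borel_measurable borel"
    by (rule iou_value_support_measurable) measurable
  have bounds: "AE x in distr M borel X. \<forall>j. 0 \<le> p x $ j \<and> p x $ j \<le> 1"
    using cond_prob_bounds by (subst AE_distr_iff) auto
  have inj: "AE x in distr M borel X. inj (($) (p x))"
    using assms(9) unfolding inj_def by (subst AE_distr_iff) auto
  \<comment> \<open>The passage to the law of \<open>X\<close> is made while the condition still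
    compares Borel functions of \<open>x\<close>, as \<open>AE_distr_iff\<close> requires; the
    argmax form is substituted afterwards.\<close>
  have "is_arg_max (IoU M X Y \<gamma>) (\<lambda>\<delta>. \<delta> \<in> segmentation_rules) \<delta>_opt \<longleftrightarrow>
      (AE x in distr M borel X. \<forall>T. iou_value \<gamma> (p x) T \<le> ?V x)"
    unfolding IoU_maximal_iff[OF assms(10)] by (subst AE_distr_iff) auto
  also have "\<dots> \<longleftrightarrow> (AE x in distr M borel X.
      \<exists>\<tau>. is_arg_max (volume_objective \<gamma> (p x)) (\<lambda>\<tau>. \<tau> \<in> {0..CARD('n)}) \<tau> \<and>
          (\<forall>j. \<delta>_opt x $ j = (if j \<in> top_set (p x) \<tau> then 1 else 0)))"
  \<comment> \<open>The pointwise equivalence holds wherever the probabilities lie in [0,1] and are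
    distinct, which is almost everywhere.\<close>
  proof (intro eventually_cong[OF eventually_conj[OF bounds inj]])
    fix x assume "(\<forall>j. 0 \<le> p x $ j \<and> p x $ j \<le> 1) \<and> inj (($) (p x))"
    moreover have "support (\<delta>_opt x) = S \<longleftrightarrow> (\<forall>j. \<delta>_opt x $ j = (if j \<in> S then 1 else 0))" for S
      using cube[of x] by (fastforce simp: support_def binary_cube_def split: if_splits)
    ultimately show "(\<forall>T. iou_value \<gamma> (p x) T \<le> ?V x) \<longleftrightarrow>
        (\<exists>\<tau>. is_arg_max (volume_objective \<gamma> (p x)) (\<lambda>\<tau>. \<tau> \<in> {0..CARD('n)}) \<tau> \<and>
          (\<forall>j. \<delta>_opt x $ j = (if j \<in> top_set (p x) \<tau> then 1 else 0)))"
      using iou_value_maximal_iff[of "p x" \<gamma> "support (\<delta>_opt x)"] \<open>0 \<le> \<gamma>\<close> by simp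
  qed
  finally show ?thesis .
qed

end
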